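(* Let $L\ge 2$ and let $\mathcal{N}$ be a positive feedforward neural network with weights $\bm{W}_l\in\mathbb{R}^{n_l\times n_{l-1}}$, biases $\bm{b}_l\in\mathbb{R}^{1\times n_l}$ ($l=1,\dots,L$, $n_0=n_L=1$) and activation functions $\sigma_l$ ($l=1,\dots,L-1$); that is, all entries of $\bm{W}_l$ and $\bm{b}_l$ are $\ge 0$ and $\sigma_l:\mathbb{R}_{\ge 0}\to\mathbb{R}_{\ge 0}$. Suppose that each $\sigma_l$ is differentiable on $\mathbb{R}_{\ge 0}$ with $\sigma_l':\mathbb{R}_{\ge 0}\to\mathbb{R}_{\ge 0}$ for $l=1,\dots,L-1$. Then $\mathcal{N}$ is monotonically increasing on $\mathbb{R}_{\ge 0}$, i.e. $\mathcal{N}(x)\le\mathcal{N}(y)$ for all $0\le x\le y$.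
   Context: Vectors are row vectors. The network maps a scalar input $x_0\in\mathbb{R}_{\ge 0}=[0,\infty)$ to $\mathcal{N}(x_0)=x_L$, where $\bm{x}_1=\sigma_1(x_0\bm{W}_1^{T}+\bm{b}_1)\in\mathbb{R}^{n_1}$, $\bm{x}_l=\sigma_l(\bm{x}_{l-1}\bm{W}_l^{T}+\bm{b}_l)\in\mathbb{R}^{n_l}$ for $2\le l\le L-1$, and $x_L=\bm{x}_{L-1}\bm{W}_L^{T}+\bm{b}_L\in\mathbb{R}$ (no activation in the last layer), with $n_0=n_L=1$ and the scalar activation functions $\sigma_l$ applied to each component separately. Derivatives at $0$ are one-sided. "Monotonically increasing" is meant in the non-strict sense. *)

theory Defs
  imports Complex_Main "HOL-Library.FuncSet" "Jordan_Normal_Form.Matrix"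
begin

text \<open>
  Row vectors in \<open>\<real>\<^sup>n\<close> are represented as \<open>1 \<times> n\<close> matrices, and \<open>n l\<close> is the width of
  layer \<open>l\<close>. Matrix entries are indexed from 0, layers as usual (input 0, output \<open>L\<close>).
\<close>

definition affine_layer :: "real mat \<Rightarrow> real mat \<Rightarrow> real mat \<Rightarrow> real mat" where
  "affine_layer A c x = x * transpose_mat A + c"

fun hidden_state ::
  "(nat \<Rightarrow> real mat) \<Rightarrow> (nat \<Rightarrow> real mat) \<Rightarrow> (nat \<Rightarrow> real \<Rightarrow> real) \<Rightarrow> real \<Rightarrow> nat \<Rightarrow> real mat"
where
  "hidden_state W b \<sigma> x\<^sub>0 0 = mat 1 1 (\<lambda>_. x\<^sub>0)"
| "hidden_state W b \<sigma> x\<^sub>0 (Suc l) =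
     map_mat (\<sigma> (Suc l)) (affine_layer (W (Suc l)) (b (Suc l)) (hidden_state W b \<sigma> x\<^sub>0 l))"

text \<open>The last layer has no activation; its value is a \<open>1 \<times> 1\<close> matrix, read off as a scalar.\<close>

definition network ::
  "nat \<Rightarrow> (nat \<Rightarrow> real mat) \<Rightarrow> (nat \<Rightarrow> real mat) \<Rightarrow> (nat \<Rightarrow> real \<Rightarrow> real) \<Rightarrow> real \<Rightarrow> real"
where
  "network L W b \<sigma> x\<^sub>0 = affine_layer (W L) (b L) (hidden_state W b \<sigma> x\<^sub>0 (L - 1)) $$ (0, 0)"

definition feedforward_network ::
  "nat \<Rightarrow> (nat \<Rightarrow> nat) \<Rightarrow> (nat \<Rightarrow> real mat) \<Rightarrow> (nat \<Rightarrow> real mat) \<Rightarrow> bool"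
where
  "feedforward_network L n W b \<longleftrightarrow>
     n 0 = 1 \<and> n L = 1 \<and>
     (\<forall>l\<in>{1..L}. W l \<in> carrier_mat (n l) (n (l - 1)) \<and> b l \<in> carrier_mat 1 (n l))"

text \<open>
  Activations are total functions on \<open>\<real>\<close>, constrained only on \<open>{0..}\<close>. In a positive network
  they are only ever applied to nonnegative arguments when the input is nonnegative.
\<close>

definition positive_network ::
  "nat \<Rightarrow> (nat \<Rightarrow> nat) \<Rightarrow> (nat \<Rightarrow> real mat) \<Rightarrow> (nat \<Rightarrow> real mat) \<Rightarrow> (nat \<Rightarrow> real \<Rightarrow> real) \<Rightarrow> bool"
where
  "positive_network L n W b \<sigma> \<longleftrightarrow>
     feedforward_network L n W b \<and>
     (\<forall>l\<in>{1..L}. (\<forall>i<n l. \<forall>j<n (l - 1). W l $$ (i, j) \<ge> 0) \<and> (\<forall>j<n l. b l $$ (0, j) \<ge> 0)) \<and>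
     (\<forall>l\<in>{1..L - 1}. \<sigma> l \<in> {0..} \<rightarrow> {0..})"

end

theory Submission
  imports Defs
begin

text \<open>A nonnegative derivative makes each activation monotone on \<open>{0..}\<close>, and
  nonnegative weights make each affine layer monotone entry by entry; the network is a composition
  of such maps. Since the activations are controlled only on \<open>{0..}\<close>, monotonicity
  alone does not pass through the layers: one also needs every pre-activation to be nonnegative,
  which follows from nonnegative weights, biases and activation values. Both facts are therefore
  carried through one induction over the layers, \<open>hidden_state_nonneg_mono\<close>; the output
  layer needs just one more use of \<open>affine_layer_mono\<close>.\<close>

text \<open>By the mean value theorem on \<open>{x..y}\<close>, derivatives are needed only strictly
  inside the interval. At the boundary point \<open>a\<close> the one-sided derivative serves only
  to give continuity.\<close>

lemma mono_on_atLeast_if_deriv_nonneg: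
  fixes f f' :: "real \<Rightarrow> real"
  assumes deriv: "\<And>x. a \<le> x \<Longrightarrow> (f has_real_derivative f' x) (at x within {a..})"
    and nonneg: "\<And>x. a \<le> x \<Longrightarrow> 0 \<le> f' x"
  shows "mono_on {a..} f"
proof (rule mono_onI)
  fix x y assume "x \<in> {a..}" "y \<in> {a..}" "x \<le> y"
  have "continuous_on {a..} f"
    using deriv by (intro DERIV_continuous_on) auto
  then have "continuous_on {x..y} f"
    by (rule continuous_on_subset) (use \<open>x \<in> {a..}\<close> in auto)
  moreover have "\<exists>d. (f has_real_derivative d) (at z) \<and> 0 \<le> d" if "x < z" for z
  proof -
    \<comment> \<open>Since a \<le> x < z, the point \<open>z\<close> is interior to
      \<open>{a..}\<close>, so the derivative there is two-sided.\<close>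
    have "at z within {a..} = at z"
      using \<open>x \<in> {a..}\<close> that by (intro at_within_open_subset[of _ "{a<..}"]) auto
    then show ?thesis
      using deriv[of z] nonneg[of z] \<open>x \<in> {a..}\<close> that by auto
  qed
  ultimately show "f x \<le> f y"
    using \<open>x \<le> y\<close> by (intro DERIV_nonneg_imp_increasing_open[of x y f]) auto
qed

lemma affine_layer_carrier:
  assumes "A \<in> carrier_mat m k" "c \<in> carrier_mat 1 m" "x \<in> carrier_mat 1 k"
  shows "affine_layer A c x \<in> carrier_mat 1 m"
  using assms by (auto simp: affine_layer_def)

lemma affine_layer_index:
  assumes "A \<in> carrier_mat m k" "c \<in> carrier_mat 1 m" "x \<in> carrier_mat 1 k" "j < m"
  shows "affine_layer A c x $$ (0, j) = (\<Sum>i<k. x $$ (0, i) * A $$ (j, i)) + c $$ (0, j)"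
  using assms by (simp add: affine_layer_def scalar_prod_def atLeast0LessThan)

text \<open>Entry \<open>j\<close> is a combination of the entries of the input with coefficients
  from row \<open>j\<close> of \<open>A\<close>, so the sign of that row decides; the bias is common
  to both sides.\<close>

lemma affine_layer_mono:
  assumes "A \<in> carrier_mat m k" "c \<in> carrier_mat 1 m" "j < m"
    and "x \<in> carrier_mat 1 k" "y \<in> carrier_mat 1 k"
    and "\<And>i. i < k \<Longrightarrow> 0 \<le> A $$ (j, i)"
    and "\<And>i. i < k \<Longrightarrow> x $$ (0, i) \<le> y $$ (0, i)"
  shows "affine_layer A c x $$ (0, j) \<le> affine_layer A c y $$ (0, j)"
  using assms by (auto simp: affine_layer_index intro!: sum_mono mult_right_mono)

lemma affine_layer_nonneg:
  assumes "A \<in> carrier_mat m k" "c \<in> carrier_mat 1 m" "j < m" "x \<in> carrier_mat 1 k"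
    and "\<And>i. i < k \<Longrightarrow> 0 \<le> A $$ (j, i)" "0 \<le> c $$ (0, j)"
    and "\<And>i. i < k \<Longrightarrow> 0 \<le> x $$ (0, i)"
  shows "0 \<le> affine_layer A c x $$ (0, j)"
  using assms by (auto simp: affine_layer_index intro!: add_nonneg_nonneg sum_nonneg)

lemma positive_networkD:
  assumes "positive_network L n W b \<sigma>" "1 \<le> l" "l \<le> L"
  shows "W l \<in> carrier_mat (n l) (n (l - 1))" "b l \<in> carrier_mat 1 (n l)"
    and "\<And>i j. i < n l \<Longrightarrow> j < n (l - 1) \<Longrightarrow> 0 \<le> W l $$ (i, j)"
    and "\<And>j. j < n l \<Longrightarrow> 0 \<le> b l $$ (0, j)"
  using assms by (auto simp: positive_network_def feedforward_network_def)

lemma hidden_state_carrier: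
  assumes "positive_network L n W b \<sigma>" "l \<le> L"
  shows "hidden_state W b \<sigma> x l \<in> carrier_mat 1 (n l)"
  using assms(2)
proof (induction l)
  case 0
  then show ?case
    using assms(1) by (auto simp: positive_network_def feedforward_network_def)
next
  case (Suc l)
  with positive_networkD(1,2)[OF assms(1), of "Suc l"] show ?case
    using affine_layer_carrier[of "W (Suc l)" "n (Suc l)" "n l"] by simp
qed

text \<open>Nonnegativity is recorded for the smaller input \<open>x\<close> only; for
  \<open>y\<close> it follows by transitivity.\<close>

lemma hidden_state_nonneg_mono:
  assumes net: "positive_network L n W b \<sigma>"
    and mono: "\<And>l. l \<in> {1..L - 1} \<Longrightarrow> mono_on {0..} (\<sigma> l)"
    and xy: "0 \<le> x" "x \<le> y"
    and "l \<le> L - 1" "j < n l"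
  shows "0 \<le> hidden_state W b \<sigma> x l $$ (0, j) \<and>
         hidden_state W b \<sigma> x l $$ (0, j) \<le> hidden_state W b \<sigma> y l $$ (0, j)"
  using assms(5,6)
proof (induction l arbitrary: j)
  case 0
  then show ?case
    using net xy by (simp add: positive_network_def feedforward_network_def)
next
  case (Suc l)
  let ?a = "\<lambda>z. affine_layer (W (Suc l)) (b (Suc l)) (hidden_state W b \<sigma> z l)"
  have carr: "hidden_state W b \<sigma> z l \<in> carrier_mat 1 (n l)" for z
    using hidden_state_carrier[OF net] Suc.prems by simp
  note D = positive_networkD[OF net, of "Suc l", simplified]
  have carr': "?a z \<in> carrier_mat 1 (n (Suc l))" for z
    using D(1,2) Suc.prems carr by (intro affine_layer_carrier[where k = "n l"]) auto
  have "0 \<le> ?a x $$ (0, j)"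
    using D Suc carr by (intro affine_layer_nonneg[where m = "n (Suc l)" and k = "n l"]) auto
  moreover have "?a x $$ (0, j) \<le> ?a y $$ (0, j)"
    using D Suc carr by (intro affine_layer_mono[where m = "n (Suc l)" and k = "n l"]) auto
  moreover have "\<sigma> (Suc l) \<in> {0..} \<rightarrow> {0..}"
    using net Suc.prems by (auto simp: positive_network_def)
  \<comment> \<open>Both pre-activations lie in \<open>{0..}\<close>, so \<open>mono\<close> applies
    to them. The dimensions in \<open>carr'\<close> allow the entry of \<open>map_mat\<close> to be
    read as the activation of an entry.\<close>
  ultimately show ?case
    using carr'[of x] carr'[of y] Suc.prems mono[of "Suc l"]
    by (auto simp: mono_on_def Pi_iff)
qed

theorem corollary2:
  fixes L :: nat and n :: "nat \<Rightarrow> nat"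
    and W b :: "nat \<Rightarrow> real mat"
    and \<sigma> \<sigma>' :: "nat \<Rightarrow> real \<Rightarrow> real"
  assumes "L \<ge> 2"
    and "positive_network L n W b \<sigma>"
    and "\<And>l x. l \<in> {1..L - 1} \<Longrightarrow> x \<in> {0..} \<Longrightarrow>
           (\<sigma> l has_real_derivative \<sigma>' l x) (at x within {0..})"
    and "\<And>l. l \<in> {1..L - 1} \<Longrightarrow> \<sigma>' l \<in> {0..} \<rightarrow> {0..}"
  shows "mono_on {0..} (network L W b \<sigma>)"
proof (rule mono_onI)
  fix x y :: real assume "x \<in> {0..}" "y \<in> {0..}" "x \<le> y"
  have mono: "mono_on {0..} (\<sigma> l)" if "l \<in> {1..L - 1}" for l
    using assms(3,4)[OF that] by (intro mono_on_atLeast_if_deriv_nonneg[of 0 _ "\<sigma>' l"]) auto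
  have "n L = 1"
    using assms(2) by (simp add: positive_network_def feedforward_network_def)
  \<comment> \<open>The output layer has no activation, so monotonicity of the affine map suffices;
    \<open>n L = 1\<close> makes entry 0 a valid index.\<close>
  then show "network L W b \<sigma> x \<le> network L W b \<sigma> y"
    unfolding network_def
    using assms(1) \<open>x \<in> {0..}\<close> \<open>x \<le> y\<close> positive_networkD[OF assms(2), of L]
      hidden_state_carrier[OF assms(2), of "L - 1"]
      hidden_state_nonneg_mono[OF assms(2) mono, of x y "L - 1"]
    by (intro affine_layer_mono[where m = "n L" and k = "n (L - 1)"]) auto
qed

end
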